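(* Let $V\in\mathbb{R}^{n\times n}$ be a covariance matrix (symmetric positive semidefinite), let $\eta=\operatorname{diag}(V)$, and let $D=\tfrac12(\eta\mathbf 1_n^\top+\mathbf 1_n\eta^\top)-V$. Let $D^-$ be a generalized inverse of $D$ (i.e. $DD^-D=D$ and $D^-DD^-=D^-$), and assume $\mathbf 1_n^\top D^-\mathbf 1_n\neq 0$, so that the maximum diversification return portfolio $\mathbf w_{\mathrm{mdrp}}=D^-\mathbf 1_n/(\mathbf 1_n^\top D^-\mathbf 1_n)$ is well defined. Let $q_{\max}=q(\mathbf w_{\mathrm{mdrp}})$. Then for every $\mathbf w\in\mathbb{R}^n$ with $\mathbf 1_n^\top\mathbf w=1$, $$c^2(\mathbf w)+q(\mathbf w)=q_{\max},$$ where $q(\mathbf w)$ is the diversification return and $c(\mathbf w)$ the centrality of $\mathbf w$.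
   Context: $\mathbf 1_n\in\mathbb{R}^n$ is the all-ones column vector and $\operatorname{diag}(V)$ is the column vector of diagonal entries of $V$. A portfolio is a vector $\mathbf w\in\mathbb{R}^n$ with $\mathbf 1_n^\top\mathbf w=1$. Its diversification return is $q(\mathbf w)=\tfrac12(\eta^\top\mathbf w-\mathbf w^\top V\mathbf w)$. Put $\mathbf s=\mathbf w_{\mathrm{mdrp}}$, $J_{\mathbf s}=I_n-\mathbf s\mathbf 1_n^\top$ and $B=-\tfrac12 J_{\mathbf s}^\top D J_{\mathbf s}$; the matrix $B$ is positive semidefinite. The centrality of $\mathbf w$ is $c(\mathbf w)=\sqrt{\mathbf w^\top B\mathbf w}$. *)

theory Defs
  imports "HOL-Analysis.Analysis"
begin

text \<open>Throughout, \<open>1 :: real ^ 'n\<close> is the all-ones vector, so \<open>1 \<bullet> w\<close> is the sum of the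
  entries of \<open>w\<close>, whereas \<open>mat 1\<close> is the identity matrix.\<close>

definition outer :: "real ^ 'm \<Rightarrow> real ^ 'n \<Rightarrow> real ^ 'n ^ 'm" where
  "outer u v = (\<chi> i j. u $ i * v $ j)"

definition diag :: "real ^ 'n ^ 'n \<Rightarrow> real ^ 'n" where
  "diag V = (\<chi> i. V $ i $ i)"

definition covariance_matrix :: "real ^ 'n ^ 'n \<Rightarrow> bool" where
  "covariance_matrix V \<longleftrightarrow> transpose V = V \<and> (\<forall>x. 0 \<le> x \<bullet> (V *v x))"

definition distance_matrix :: "real ^ 'n ^ 'n \<Rightarrow> real ^ 'n ^ 'n" where
  "distance_matrix V = (1/2) *\<^sub>R (outer (diag V) 1 + outer 1 (diag V)) - V"

text \<open>Such an inverse is in general neither unique nor symmetric.\<close>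

definition generalized_inverse :: "real ^ 'n ^ 'n \<Rightarrow> real ^ 'n ^ 'n \<Rightarrow> bool" where
  "generalized_inverse D G \<longleftrightarrow> D ** G ** D = D \<and> G ** D ** G = G"

definition diversification_return :: "real ^ 'n ^ 'n \<Rightarrow> real ^ 'n \<Rightarrow> real" where
  "diversification_return V w = (1/2) * (diag V \<bullet> w - w \<bullet> (V *v w))"

text \<open>The maximum diversification return portfolio determined by a generalized inverse \<open>G\<close>
  of the distance matrix; meaningful only if \<open>1 \<bullet> (G *v 1) \<noteq> 0\<close>.\<close>

definition mdr_portfolio :: "real ^ 'n ^ 'n \<Rightarrow> real ^ 'n" where
  "mdr_portfolio G = (1 / (1 \<bullet> (G *v 1))) *\<^sub>R (G *v 1)"

definition centering_matrix :: "real ^ 'n \<Rightarrow> real ^ 'n ^ 'n" where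
  "centering_matrix s = mat 1 - outer s 1"

definition centrality_matrix :: "real ^ 'n ^ 'n \<Rightarrow> real ^ 'n \<Rightarrow> real ^ 'n ^ 'n" where
  "centrality_matrix V s =
     (- 1/2) *\<^sub>R (transpose (centering_matrix s) ** distance_matrix V ** centering_matrix s)"

text \<open>The library's \<open>sqrt\<close> is odd, hence not the usual square root on negative arguments; for a
  covariance matrix \<open>V\<close> and \<open>1 \<bullet> s = 1\<close> the radicand is nonnegative.\<close>

definition centrality :: "real ^ 'n ^ 'n \<Rightarrow> real ^ 'n \<Rightarrow> real ^ 'n \<Rightarrow> real" where
  "centrality V s w = sqrt (w \<bullet> (centrality_matrix V s *v w))"

end

theory Submission
  imports Defs
begin

text \<open>The form \<open>D\<close> agrees with \<open>- V\<close> on the hyperplane \<open>1 \<bullet> z = 0\<close>, and \<open>q w = (w \<bullet> D w) / 2\<close>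
  when \<open>1 \<bullet> w = 1\<close>. Expanding \<open>(w - s) \<bullet> D (w - s)\<close> therefore gives the claim as soon as \<open>D s\<close>
  is a multiple of \<open>1\<close>, that is, as soon as \<open>D G 1 = 1\<close>. If this failed, some \<open>x\<close> in the kernel
  of \<open>D\<close> would satisfy \<open>1 \<bullet> x \<noteq> 0\<close>; moving any vector along \<open>x\<close> into the hyperplane shows that
  \<open>D\<close> is negative semidefinite, and its diagonal being zero, \<open>D = 0\<close>. Then \<open>G = G D G = 0\<close>,
  against \<open>1 \<bullet> G 1 \<noteq> 0\<close>.\<close>

lemma outer_mult_vec: "outer u v *v x = (v \<bullet> x) *\<^sub>R u"
  by (simp add: outer_def matrix_vector_mult_def inner_vec_def vec_eq_iff sum_distrib_left
      mult_ac)

text \<open>The two rank-one summands of \<open>D\<close> contribute products of linear forms, each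
  with a factor \<open>1 \<bullet> u\<close> or \<open>1 \<bullet> v\<close>. They vanish on the
  hyperplane and reduce to \<open>diag V \<bullet> w\<close> on portfolios.\<close>

lemma inner_distance_matrix:
  "u \<bullet> (distance_matrix V *v v) =
     (1/2) * ((diag V \<bullet> u) * (1 \<bullet> v) + (1 \<bullet> u) * (diag V \<bullet> v)) - u \<bullet> (V *v v)"
  by (simp add: distance_matrix_def matrix_vector_mult_diff_rdistrib
      matrix_vector_mult_add_rdistrib scaleR_matrix_vector_assoc[symmetric] outer_mult_vec
      inner_simps inner_commute algebra_simps)

lemma distance_matrix_inner_hyperplane:
  "1 \<bullet> z = 0 \<Longrightarrow> z \<bullet> (distance_matrix V *v z) = - (z \<bullet> (V *v z))"
  by (simp add: inner_distance_matrix)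

lemma diversification_return_eq:
  "1 \<bullet> w = 1 \<Longrightarrow> diversification_return V w = (1/2) * (w \<bullet> (distance_matrix V *v w))"
  by (simp add: inner_distance_matrix diversification_return_def)

lemma transpose_distance_matrix:
  "transpose V = V \<Longrightarrow> transpose (distance_matrix V) = distance_matrix V"
  by (simp add: distance_matrix_def outer_def transpose_def vec_eq_iff mult_ac add_ac)

lemma inner_matrix_vector_commute:
  fixes A :: "real ^ 'n ^ 'n"
  assumes "transpose A = A"
  shows "u \<bullet> (A *v v) = v \<bullet> (A *v u)"
  by (metis assms dot_lmul_matrix inner_commute transpose_matrix_vector)

lemma inner_axis_matrix_axis:
  fixes A :: "real ^ 'n ^ 'n"
  shows "axis i 1 \<bullet> (A *v axis j 1) = A $ i $ j"
  by (simp add: matrix_vector_mul_component inner_axis' inner_axis)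

text \<open>With zero diagonal, the form takes the values \<open>2 * A $ i $ j\<close> and
  \<open>- 2 * A $ i $ j\<close> at the sum and the difference of two distinct axis vectors, and
  both must be nonpositive.\<close>

lemma negative_semidefinite_zero_diagonal:
  fixes A :: "real ^ 'n ^ 'n"
  assumes sym: "transpose A = A"
    and nsd: "\<And>x. x \<bullet> (A *v x) \<le> 0"
    and diag: "\<And>i. A $ i $ i = 0"
  shows "A = 0"
proof -
  have "A $ i $ j = 0" for i j
  proof -
    have "A $ j $ i = A $ i $ j"
      using sym by (metis transpose_def vec_lambda_beta)
    then show ?thesis
      using nsd[of "axis i 1 + axis j 1"] nsd[of "axis i 1 - axis j 1"]
      by (simp add: matrix_vector_right_distrib matrix_vector_mult_diff_distrib inner_add_left
          inner_add_right inner_diff_left inner_diff_right inner_axis_matrix_axis diag)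
  qed
  then show ?thesis by (simp add: vec_eq_iff)
qed

lemma distance_matrix_eq_0_if_kernel:
  assumes V: "covariance_matrix V"
    and x: "distance_matrix V *v x = 0" "1 \<bullet> x \<noteq> 0"
  shows "distance_matrix V = 0"
proof (rule negative_semidefinite_zero_diagonal)
  let ?D = "distance_matrix V"
  show sym: "transpose ?D = ?D"
    using V by (simp add: covariance_matrix_def transpose_distance_matrix)
  show "?D $ i $ i = 0" for i
    by (simp add: distance_matrix_def outer_def diag_def)
  show "v \<bullet> (?D *v v) \<le> 0" for v
  proof -
    define z where "z = v - ((1 \<bullet> v) / (1 \<bullet> x)) *\<^sub>R x"
    \<comment> \<open>By symmetry \<open>x\<close> annihilates \<open>D\<close> from the left as
      well, so shifting \<open>v\<close> along \<open>x\<close> leaves the value of the form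
      unchanged.\<close>
    have "x \<bullet> (?D *v v) = 0"
      using x(1) inner_matrix_vector_commute[OF sym, of x v] by simp
    then have "v \<bullet> (?D *v v) = z \<bullet> (?D *v z)"
      by (simp add: z_def matrix_vector_mult_diff_distrib matrix_vector_mult_scaleR x(1)
          inner_diff_left)
    also have "1 \<bullet> z = 0"
      using x(2) by (simp add: z_def inner_diff_right)
    then have "z \<bullet> (?D *v z) \<le> 0"
      using V by (simp add: distance_matrix_inner_hyperplane covariance_matrix_def)
    finally show ?thesis .
  qed
qed

lemma distance_matrix_generalized_inverse_one:
  assumes V: "covariance_matrix V"
    and G: "generalized_inverse (distance_matrix V) G"
    and nz: "1 \<bullet> (G *v 1) \<noteq> 0"
  shows "distance_matrix V *v (G *v 1) = 1"
proof (rule ccontr)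
  let ?D = "distance_matrix V"
  assume "?D *v (G *v 1) \<noteq> 1"
  \<comment> \<open>The residual \<open>y\<close> is corrected to a kernel vector \<open>x\<close>.
    The transpose of \<open>G\<close> is used because \<open>G\<close> need not be symmetric: it
    still satisfies the first inverse identity, so \<open>D\<close> kills \<open>x\<close>, and
    moving it across the inner product produces \<open>D G 1\<close>, so that
    \<open>1 \<bullet> x = y \<bullet> y\<close>.\<close>
  define y where "y = 1 - ?D *v (G *v 1)"
  define x where "x = y - transpose G *v (?D *v y)"
  have sym: "transpose ?D = ?D"
    using V by (simp add: covariance_matrix_def transpose_distance_matrix)
  have "?D ** transpose G ** ?D = transpose (?D ** G ** ?D)"
    by (simp add: matrix_transpose_mul sym matrix_mul_assoc)
  also have "\<dots> = ?D"
    using G sym by (simp add: generalized_inverse_def)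
  finally have "?D *v x = 0"
    by (simp add: x_def matrix_vector_mult_diff_distrib matrix_vector_mul_assoc
        matrix_mul_assoc)
  moreover have "1 \<bullet> (transpose G *v (?D *v y)) = (?D *v (G *v 1)) \<bullet> y"
    by (metis dot_lmul_matrix inner_commute inner_matrix_vector_commute sym
        transpose_matrix_vector)
  then have "1 \<bullet> x = y \<bullet> y"
    unfolding x_def by (simp add: inner_diff_right) (simp add: y_def inner_diff_left)
  then have "1 \<bullet> x \<noteq> 0"
    using \<open>?D *v (G *v 1) \<noteq> 1\<close> by (simp add: y_def)
  ultimately have "?D = 0"
    by (rule distance_matrix_eq_0_if_kernel[OF V])
  then have "G = 0"
    using G by (simp add: generalized_inverse_def)
  then show False
    using nz by simp
qed

lemma inner_centrality_matrix:
  assumes "1 \<bullet> w = 1"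
  shows "w \<bullet> (centrality_matrix V s *v w) = - (1/2) * ((w - s) \<bullet> (distance_matrix V *v (w - s)))"
proof -
  have J: "centering_matrix s *v w = w - s"
    using assms by (simp add: centering_matrix_def matrix_vector_mult_diff_rdistrib
        outer_mult_vec)
  have "w \<bullet> (transpose (centering_matrix s) *v u) = (w - s) \<bullet> u" for u
    by (metis J dot_lmul_matrix inner_commute transpose_matrix_vector)
  then show ?thesis
    by (simp only: centrality_matrix_def scaleR_matrix_vector_assoc[symmetric]
        matrix_vector_mul_assoc[symmetric] J inner_scaleR_right)
qed

theorem proposition5:
  fixes V G :: "real ^ 'n ^ 'n" and w :: "real ^ 'n"
  assumes "covariance_matrix V"
    and "generalized_inverse (distance_matrix V) G"
    and "1 \<bullet> (G *v 1) \<noteq> 0"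
    and "1 \<bullet> w = 1"
  shows "(centrality V (mdr_portfolio G) w)\<^sup>2 + diversification_return V w
         = diversification_return V (mdr_portfolio G)"
proof -
  let ?D = "distance_matrix V"
  define s where "s = mdr_portfolio G"
  define k where "k = 1 / (1 \<bullet> (G *v 1))"
  have s1: "1 \<bullet> s = 1"
    using assms(3) by (simp add: s_def mdr_portfolio_def)
  have Ds: "?D *v s = k *\<^sub>R 1"
    using distance_matrix_generalized_inverse_one[OF assms(1-3)]
    by (simp add: s_def mdr_portfolio_def matrix_vector_mult_scaleR k_def)
  have sym: "transpose ?D = ?D"
    using assms(1) by (simp add: covariance_matrix_def transpose_distance_matrix)
  have uDs: "u \<bullet> (?D *v s) = k" if "1 \<bullet> u = 1" for u
    using that by (simp add: Ds inner_commute)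
  have "1 \<bullet> (w - s) = 0"
    using assms(4) s1 by (simp add: inner_diff_right)
  \<comment> \<open>Nonnegativity of the radicand is what lets the square cancel
    \<open>sqrt\<close>.\<close>
  then have "0 \<le> - (1/2) * ((w - s) \<bullet> (?D *v (w - s)))"
    using assms(1) by (simp add: distance_matrix_inner_hyperplane covariance_matrix_def)
  then have "(centrality V s w)\<^sup>2 = - (1/2) * ((w - s) \<bullet> (?D *v (w - s)))"
    by (simp add: centrality_def inner_centrality_matrix[OF assms(4)])
  \<comment> \<open>Both cross terms and the term in \<open>s\<close> alone equal \<open>k\<close>,
    which leaves \<open>- k - k + k = - k\<close>.\<close>
  also have "\<dots> = - (1/2) * (w \<bullet> (?D *v w) - k)"
    using uDs[OF assms(4)] uDs[OF s1] inner_matrix_vector_commute[OF sym, of s w]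
    by (simp add: matrix_vector_mult_diff_distrib inner_diff_left inner_diff_right)
  finally show ?thesis
    \<comment> \<open>The maximal return is \<open>k / 2\<close>, since
      \<open>s \<bullet> (D *v s) = k\<close>.\<close>
    using uDs[OF s1]
    by (simp add: diversification_return_eq assms(4) s1 algebra_simps flip: s_def)
qed

end
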